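(* Let $AP$ be a finite set, let $\mathcal{A}=(Q,2^{AP},\delta,Q_0,F)$ be a complete nondeterministic Büchi automaton (NBA), and let $M=(S,P,I,AP,L)$ be a finite possibilistic Kripke structure. Then for all states $s$ in $M$, $$Po^M(s\models\mathcal{A})=Po^{M\otimes\mathcal{A}}\big(\langle s,\delta(q_0,L(s))\rangle\models\square\lozenge B\big),\qquad B=S\times F.$$
   Context: For subsets or families in $[0,1]$, $\vee$ denotes supremum and $\wedge$ infimum (with $\bigvee\emptyset=0$). A possibilistic Kripke structure is a tuple $M=(S,P,I,AP,L)$ where $S$ is a countable nonempty set of states; $P:S\times S\to[0,1]$ satisfies $\bigvee_{s'\in S}P(s,s')=1$ for all $s\in S$; $I:S\to[0,1]$ satisfies $\bigvee_{s\in S}I(s)=1$; $AP$ is a set of atomic propositions; and $L:S\to 2^{AP}$ is a labeling function. It is finite if $S$ and $AP$ are finite. A path is an infinite sequence $\pi=s_0s_1\cdots\in S^\omega$ with $P(s_i,s_{i+1})>0$ for all $i\ge 0$; $Paths(s)$ is the set of paths with $s_0=s$; $trace(\pi)=L(s_0)L(s_1)\cdots\in(2^{AP})^\omega$. Define $Po^M(\pi)=I(s_0)\wedge\bigwedge_{i=0}^\infty P(s_i,s_{i+1})$ and $Po^M(E)=\bigvee_{\pi\in E}Po^M(\pi)$ for a set $E$ of paths. $M_s$ is $M$ with $I$ replaced by the distribution that is $1$ at $s$ and $0$ elsewhere. For a set of paths $E$, $Po^M(s\models E)=Po^{M_s}(E\cap Paths(s))$. For a set $B$ of states, $\square\lozenge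 B$ is the set of paths that visit $B$ infinitely often. An NBA $\mathcal{A}=(Q,\Sigma,\delta,Q_0,F)$ has a finite state set $Q$, finite alphabet $\Sigma$, transition function $\delta:Q\times\Sigma\to2^Q$, initial states $Q_0\subseteq Q$ and accept states $F\subseteq Q$; $L_\omega(\mathcal A)\subseteq\Sigma^\omega$ is the set of infinite words $u_1u_2\cdots$ having a run $q_0q_1\cdots$ with $q_0\in Q_0$, $q_{i+1}\in\delta(q_i,u_{i+1})$ for all $i\ge0$, and $q_i\in F$ for infinitely many $i$. $\mathcal A$ is complete if $\delta(q,u)\ne\emptyset$ for all $q\in Q$, $u\in\Sigma$. Define $Po^M(s\models\mathcal A)=Po^{M_s}(\{\pi\in Paths(s)\mid trace(\pi)\in L_\omega(\mathcal A)\})$. The product $M\otimes\mathcal A=(S\times Q,P',I',AP',L')$ is given by $AP'=S\times Q$, $L'(\langle s,q\rangle)=\{\langle s,q\rangle\}$; $I'(\langle s,q\rangle)=I(s)$ if $q\in\delta(q_0,L(s))$ for some $q_0\in Q_0$, and $0$ otherwise; $P'(\langle s,q\rangle,\langle s',q'\rangle)=P(s,s')$ if $q'\in\delta(q,L(s'))$, and $0$ otherwise. Here $Po^{M\otimes\mathcal A}(\langle s,\delta(q_0,L(s))\rangle\models E)$ means the supremum of $Po^{M\otimes\mathcal A}(\langle s,q\rangle\models E)$ over all $q\in\delta(q_0,L(s))$ with $q_0\in Q_0$. *)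

theory Defs
  imports Complex_Main "HOL-Library.Countable_Set"
begin

(* Supremum of a subset of [0,1]. The supremum of the empty set of reals is unspecified in HOL;
   inserting 0 makes it 0 and does not affect nonempty subsets of [0,1]. *)
definition sup01 :: "real set \<Rightarrow> real" where
  "sup01 X = Sup (insert 0 X)"

record ('s, 'ap) pks =
  states :: "'s set"
  tposs :: "'s \<Rightarrow> 's \<Rightarrow> real"
  iposs :: "'s \<Rightarrow> real"
  atoms :: "'ap set"
  labels :: "'s \<Rightarrow> 'ap set"

definition is_pks :: "('s, 'ap) pks \<Rightarrow> bool" where
  "is_pks M \<longleftrightarrow>
     countable (states M) \<and> states M \<noteq> {} \<and>
     (\<forall>s \<in> states M. \<forall>t \<in> states M. tposs M s t \<in> {0..1}) \<and>
     (\<forall>s \<in> states M. sup01 (tposs M s ` states M) = 1) \<and>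
     (\<forall>s \<in> states M. iposs M s \<in> {0..1}) \<and>
     sup01 (iposs M ` states M) = 1 \<and>
     (\<forall>s \<in> states M. labels M s \<subseteq> atoms M)"

definition finite_pks :: "('s, 'ap) pks \<Rightarrow> bool" where
  "finite_pks M \<longleftrightarrow> is_pks M \<and> finite (states M) \<and> finite (atoms M)"

definition paths :: "('s, 'ap) pks \<Rightarrow> (nat \<Rightarrow> 's) set" where
  "paths M = {\<pi>. \<forall>i. \<pi> i \<in> states M \<and> tposs M (\<pi> i) (\<pi> (Suc i)) > 0}"

definition paths_from :: "('s, 'ap) pks \<Rightarrow> 's \<Rightarrow> (nat \<Rightarrow> 's) set" where
  "paths_from M s = {\<pi> \<in> paths M. \<pi> 0 = s}"

definition trace :: "('s, 'ap) pks \<Rightarrow> (nat \<Rightarrow> 's) \<Rightarrow> (nat \<Rightarrow> 'ap set)" where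
  "trace M \<pi> = (\<lambda>i. labels M (\<pi> i))"

definition po_path :: "('s, 'ap) pks \<Rightarrow> (nat \<Rightarrow> 's) \<Rightarrow> real" where
  "po_path M \<pi> = min (iposs M (\<pi> 0)) (INF i. tposs M (\<pi> i) (\<pi> (Suc i)))"

definition po :: "('s, 'ap) pks \<Rightarrow> (nat \<Rightarrow> 's) set \<Rightarrow> real" where
  "po M E = sup01 (po_path M ` E)"

definition start_at :: "('s, 'ap) pks \<Rightarrow> 's \<Rightarrow> ('s, 'ap) pks" where
  "start_at M s = M\<lparr>iposs := (\<lambda>t. if t = s then 1 else 0)\<rparr>"

definition po_sat :: "('s, 'ap) pks \<Rightarrow> 's \<Rightarrow> (nat \<Rightarrow> 's) set \<Rightarrow> real" where
  "po_sat M s E = po (start_at M s) (E \<inter> paths_from M s)"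

definition always_eventually :: "('s, 'ap) pks \<Rightarrow> 's set \<Rightarrow> (nat \<Rightarrow> 's) set" where
  "always_eventually M B = {\<pi> \<in> paths M. infinite {i. \<pi> i \<in> B}}"

record ('q, 'a) nba =
  nba_states :: "'q set"
  alphabet :: "'a set"
  delta :: "'q \<Rightarrow> 'a \<Rightarrow> 'q set"
  initial :: "'q set"
  accept :: "'q set"

definition is_nba :: "('q, 'a) nba \<Rightarrow> bool" where
  "is_nba A \<longleftrightarrow>
     finite (nba_states A) \<and> finite (alphabet A) \<and>
     (\<forall>q \<in> nba_states A. \<forall>u \<in> alphabet A. delta A q u \<subseteq> nba_states A) \<and>
     initial A \<subseteq> nba_states A \<and> accept A \<subseteq> nba_states A"

definition nba_complete :: "('q, 'a) nba \<Rightarrow> bool" where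
  "nba_complete A \<longleftrightarrow> (\<forall>q \<in> nba_states A. \<forall>u \<in> alphabet A. delta A q u \<noteq> {})"

(* Letters are indexed from 0 here: w i is the (i+1)-st letter of the word, the one read in
   the step from r i to r (i+1). *)
definition language :: "('q, 'a) nba \<Rightarrow> (nat \<Rightarrow> 'a) set" where
  "language A = {w. (\<forall>i. w i \<in> alphabet A) \<and>
     (\<exists>r. r 0 \<in> initial A \<and> (\<forall>i. r (Suc i) \<in> delta A (r i) (w i)) \<and>
          infinite {i. r i \<in> accept A})}"

definition po_sat_nba :: "('s, 'ap) pks \<Rightarrow> 's \<Rightarrow> ('q, 'ap set) nba \<Rightarrow> real" where
  "po_sat_nba M s A = po (start_at M s) {\<pi> \<in> paths_from M s. trace M \<pi> \<in> language A}"

definition product ::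
  "('s, 'ap) pks \<Rightarrow> ('q, 'ap set) nba \<Rightarrow> ('s \<times> 'q, 's \<times> 'q) pks" where
  "product M A = \<lparr>
     states = states M \<times> nba_states A,
     tposs = (\<lambda>(s, q) (s', q'). if q' \<in> delta A q (labels M s') then tposs M s s' else 0),
     iposs = (\<lambda>(s, q). if \<exists>q0 \<in> initial A. q \<in> delta A q0 (labels M s) then iposs M s else 0),
     atoms = states M \<times> nba_states A,
     labels = (\<lambda>x. {x})\<rparr>"

(* The possibility of E from the family of product states (s, q) with q reached from some
   initial automaton state on reading the label of s. *)
definition po_sat_product ::
  "('s, 'ap) pks \<Rightarrow> ('q, 'ap set) nba \<Rightarrow> 's \<Rightarrow> (nat \<Rightarrow> 's \<times> 'q) set \<Rightarrow> real" where
  "po_sat_product M A s E =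
     sup01 {po_sat (product M A) (s, q) E |q. \<exists>q0 \<in> initial A. q \<in> delta A q0 (labels M s)}"

end

(* A path of M together with an accepting run r on its trace corresponds to the path
   i |-> (path i, r (i+1)) of the product: the component in A is shifted by one because the
   product reads the label of its initial state at the start.  This correspondence preserves all
   transition possibilities, so both sides are suprema of the same set of reals. *)
theory Submission
  imports Defs
begin

lemma sup01_le_iff:
  assumes "bdd_above X"
  shows "sup01 X \<le> c \<longleftrightarrow> 0 \<le> c \<and> (\<forall>x \<in> X. x \<le> c)"
  using assms by (simp add: sup01_def cSup_le_iff)

text \<open>Both sides have the same upper bounds \<open>c\<close>, which forces equality. The
  \<open>0\<close> inserted at each level only adds the condition \<open>0 \<le> c\<close>, so empty
  families need no separate treatment.\<close>

lemma sup01_UN: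
  assumes "bdd_above (\<Union>i \<in> J. X i)"
  shows "sup01 ((\<lambda>i. sup01 (X i)) ` J) = sup01 (\<Union>i \<in> J. X i)"
proof -
  have bdd: "bdd_above (X i)" if "i \<in> J" for i
    using assms that by (rule bdd_above_mono[OF _ UN_upper])
  have upper: "sup01 (X i) \<le> sup01 (\<Union>i \<in> J. X i)" if "i \<in> J" for i
    using sup01_le_iff[OF assms, THEN iffD1, OF order_refl] that
    by (auto simp: sup01_le_iff[OF bdd])
  have "bdd_above ((\<lambda>i. sup01 (X i)) ` J)"
    using upper by (intro bdd_aboveI2)
  then have "sup01 ((\<lambda>i. sup01 (X i)) ` J) \<le> c \<longleftrightarrow> sup01 (\<Union>i \<in> J. X i) \<le> c" for c
    by (auto simp: sup01_le_iff assms bdd)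
  then show ?thesis
    by (meson order.antisym order.refl)
qed

lemma po_path_start_at:
  assumes "\<pi> 0 = s"
  shows "po_path (start_at M s) \<pi> = min 1 (INF i. tposs M (\<pi> i) (\<pi> (Suc i)))"
  using assms by (simp add: po_path_def start_at_def)

lemma tposs_product:
  "tposs (product M A) x y =
     (if snd y \<in> delta A (snd x) (labels M (fst y)) then tposs M (fst x) (fst y) else 0)"
  by (simp add: product_def split_beta)

text \<open>\<open>is_nba\<close> controls \<open>delta\<close> only on letters of the alphabet, so
  \<open>letters\<close> is what keeps the run inside \<open>nba_states A\<close>.\<close>

lemma product_path_of_run:
  assumes "is_nba A" and letters: "labels M ` states M \<subseteq> alphabet A"
    and path: "\<pi> \<in> paths M" and r0: "r 0 \<in> initial A"
    and step: "\<And>i. r (Suc i) \<in> delta A (r i) (trace M \<pi> i)"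
  shows "(\<lambda>i. (\<pi> i, r (Suc i))) \<in> paths (product M A)"
proof -
  have "r i \<in> nba_states A" for i
  proof (induction i)
    case 0
    then show ?case using r0 assms(1) by (auto simp: is_nba_def)
  next
    case (Suc i)
    have "trace M \<pi> i \<in> alphabet A"
      using letters path by (auto simp: trace_def paths_def)
    then show ?case using Suc step[of i] assms(1) by (auto simp: is_nba_def)
  qed
  then show ?thesis
    using path step by (auto simp: paths_def tposs_product trace_def) (auto simp: product_def)
qed

text \<open>A positive product transition cannot come from the default value 0, so it is a move of
  the automaton and keeps the possibility it has in \<open>M\<close>.\<close>

lemma path_of_product_path:
  assumes "\<sigma> \<in> paths (product M A)"
  shows "fst \<circ> \<sigma> \<in> paths M"
    and "snd (\<sigma> (Suc i)) \<in> delta A (snd (\<sigma> i)) (labels M (fst (\<sigma> (Suc i))))"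
    and "tposs (product M A) (\<sigma> i) (\<sigma> (Suc i)) = tposs M (fst (\<sigma> i)) (fst (\<sigma> (Suc i)))"
proof -
  have st: "fst (\<sigma> i) \<in> states M" for i
    using assms by (auto simp: paths_def product_def mem_Times_iff)
  have pos: "tposs (product M A) (\<sigma> i) (\<sigma> (Suc i)) > 0" for i
    using assms by (simp add: paths_def)
  show step: "snd (\<sigma> (Suc i)) \<in> delta A (snd (\<sigma> i)) (labels M (fst (\<sigma> (Suc i))))" for i
    using pos[of i] by (auto simp: tposs_product split: if_splits)
  then show eq: "tposs (product M A) (\<sigma> i) (\<sigma> (Suc i)) = tposs M (fst (\<sigma> i)) (fst (\<sigma> (Suc i)))" for i
    by (simp add: tposs_product)
  show "fst \<circ> \<sigma> \<in> paths M"
    using st pos eq by (simp add: paths_def)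
qed

text \<open>Absorbs the shift by one between runs and product paths. Infinitude is the negation of a
  cofinite statement, and on the naturals the cofinite filter is \<open>sequentially\<close>, which
  ignores index shifts.\<close>

lemma infinite_Collect_Suc:
  "infinite {i. P (Suc i)} \<longleftrightarrow> infinite {i. P i}"
  using eventually_sequentially_Suc[of "\<lambda>i. \<not> P i"]
  by (simp flip: cofinite_eq_sequentially add: eventually_cofinite)

lemma po_path_image_product:
  assumes "is_nba A" and letters: "labels M ` states M \<subseteq> alphabet A"
    and "s \<in> states M"
  shows "po_path (start_at M s) ` {\<pi> \<in> paths_from M s. trace M \<pi> \<in> language A} =
    (\<Union>q \<in> {q. \<exists>q0 \<in> initial A. q \<in> delta A q0 (labels M s)}.
       po_path (start_at (product M A) (s, q)) `
         (always_eventually (product M A) (states M \<times> accept A) \<inter> paths_from (product M A) (s, q)))"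
    (is "?L = (\<Union>q \<in> ?Q. ?R q)")
proof (intro equalityI subsetI)
  fix x
  assume "x \<in> ?L"
  then obtain \<pi> r where path: "\<pi> \<in> paths M" and "\<pi> 0 = s"
    and x: "x = po_path (start_at M s) \<pi>" and "r 0 \<in> initial A"
    and step: "\<And>i. r (Suc i) \<in> delta A (r i) (trace M \<pi> i)"
    and inf: "infinite {i. r i \<in> accept A}"
    by (auto simp: paths_from_def language_def)
  let ?\<sigma> = "\<lambda>i. (\<pi> i, r (Suc i))"
  have \<sigma>: "?\<sigma> \<in> paths (product M A)"
    using assms(1) letters path \<open>r 0 \<in> initial A\<close> step by (rule product_path_of_run)
  \<comment> \<open>The first component never leaves \<open>states M\<close>, so visits to the
    target set depend on the run alone.\<close>
  have "{i. ?\<sigma> i \<in> states M \<times> accept A} = {i. r (Suc i) \<in> accept A}"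
    using path by (auto simp: paths_def)
  then have "?\<sigma> \<in> always_eventually (product M A) (states M \<times> accept A)"
    using \<sigma> inf infinite_Collect_Suc[of "\<lambda>i. r i \<in> accept A"]
    by (simp add: always_eventually_def)
  moreover have "?\<sigma> \<in> paths_from (product M A) (s, r 1)"
    using \<sigma> \<open>\<pi> 0 = s\<close> by (simp add: paths_from_def)
  moreover have "x = po_path (start_at (product M A) (s, r 1)) ?\<sigma>"
    using path_of_product_path(3)[OF \<sigma>] \<open>\<pi> 0 = s\<close> by (simp add: x po_path_start_at)
  ultimately have "x \<in> ?R (r 1)"
    by blast
  moreover have "r 1 \<in> ?Q"
    using step[of 0] \<open>r 0 \<in> initial A\<close> \<open>\<pi> 0 = s\<close> by (auto simp: trace_def)
  ultimately show "x \<in> (\<Union>q \<in> ?Q. ?R q)"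
    by blast
next
  fix x
  assume "x \<in> (\<Union>q \<in> ?Q. ?R q)"
  then obtain q q0 \<sigma> where q0: "q0 \<in> initial A" "q \<in> delta A q0 (labels M s)"
    and \<sigma>: "\<sigma> \<in> paths (product M A)" "\<sigma> 0 = (s, q)"
    and inf: "infinite {i. \<sigma> i \<in> states M \<times> accept A}"
    and x: "x = po_path (start_at (product M A) (s, q)) \<sigma>"
    by (auto simp: paths_from_def always_eventually_def)
  note proj = path_of_product_path[OF \<sigma>(1)]
  \<comment> \<open>The product path starts after the first letter has been read; prepending
    \<open>q0\<close> restores the missing initial state.\<close>
  define r where "r = case_nat q0 (snd \<circ> \<sigma>)"
  have "r (Suc i) \<in> delta A (r i) (trace M (fst \<circ> \<sigma>) i)" for i
    using q0 \<sigma>(2) proj(2) by (cases i) (simp_all add: r_def trace_def)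
  moreover have "infinite {i. r i \<in> accept A}"
  proof -
    have "{i. \<sigma> i \<in> states M \<times> accept A} \<subseteq> {i. r (Suc i) \<in> accept A}"
      by (auto simp: r_def mem_Times_iff)
    then show ?thesis
      using inf infinite_Collect_Suc[of "\<lambda>i. r i \<in> accept A"] infinite_super by blast
  qed
  moreover have "trace M (fst \<circ> \<sigma>) i \<in> alphabet A" for i
    using letters proj(1) by (auto simp: trace_def paths_def)
  moreover have "r 0 \<in> initial A"
    using q0 by (simp add: r_def)
  ultimately have "trace M (fst \<circ> \<sigma>) \<in> language A"
    by (auto simp: language_def)
  moreover have "fst \<circ> \<sigma> \<in> paths_from M s"
    using proj(1) \<sigma>(2) by (simp add: paths_from_def)
  moreover have "x = po_path (start_at M s) (fst \<circ> \<sigma>)"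
    using proj(3) \<sigma>(2) by (simp add: x po_path_start_at)
  ultimately show "x \<in> ?L"
    by blast
qed

theorem theorem20:
  fixes AP :: "'ap set" and A :: "('q, 'ap set) nba" and M :: "('s, 'ap) pks"
  assumes "finite AP"
    and "is_nba A" and "alphabet A = Pow AP" and "nba_complete A"
    and "finite_pks M" and "atoms M = AP"
  shows "\<forall>s \<in> states M.
    po_sat_nba M s A =
    po_sat_product M A s (always_eventually (product M A) (states M \<times> accept A))"
proof
  fix s
  assume "s \<in> states M"
  let ?E = "{\<pi> \<in> paths_from M s. trace M \<pi> \<in> language A}"
  have letters: "labels M ` states M \<subseteq> alphabet A"
    using assms by (auto simp: finite_pks_def is_pks_def)
  note image = po_path_image_product[OF assms(2) letters \<open>s \<in> states M\<close>]
  have "bdd_above (po_path (start_at M s) ` ?E)"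
    \<comment> \<open>The initial possibility 1 at \<open>s\<close> caps every value, whatever the
      infimum is.\<close>
    by (rule bdd_aboveI2[of _ _ 1]) (simp add: paths_from_def po_path_start_at)
  then show "po_sat_nba M s A =
      po_sat_product M A s (always_eventually (product M A) (states M \<times> accept A))"
    \<comment> \<open>Rewriting with \<open>image\<close> also turns the chained bound into one on
      the union, as \<open>sup01_UN\<close> requires.\<close>
    unfolding po_sat_nba_def po_sat_product_def po_sat_def po_def setcompr_eq_image image
    by (rule sup01_UN[symmetric])
qed

end
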